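(* Let $X$ be a Banach space and let $\mathcal{A}$ be the global attractor of a semigroup $\{S(t)\}_{t\ge 0}$ on $X$, with $R_{\mathcal{A}}:=\sup_{u\in\mathcal{A}}\|u\|_X<\infty$. Assume that there is a projection $P:X\to PX$ of finite rank $\Lambda=\dim PX\ge 1$, and that there exist positive numbers $t_0,M_1,M_2,M_3$ and constants $\lambda_0,\lambda_1\in\mathbb{R}$ such that for all $\varphi,\psi\in\mathcal{A}$ $$\|PS(t_0)\varphi-PS(t_0)\psi\|\le M_1e^{\lambda_0t_0}\|\varphi-\psi\|,$$ $$\|(I-P)S(t_0)\varphi-(I-P)S(t_0)\psi\|\le\left(M_2e^{\lambda_1t_0}+M_3e^{\lambda_0t_0}\right)\|\varphi-\psi\|.$$ Assume also that there exists $0<\alpha<M_1$ such that $$\zeta:=\alpha e^{\lambda_0t_0}+M_2e^{\lambda_1t_0}+M_3e^{\lambda_0t_0}<1.$$ Then the fractal dimension of $\mathcal{A}$ satisfies $$\dim_f\mathcal{A}\le\frac{\ln\Lambda+\Lambda\ln\left(2+\frac{2M_1}{\alpha}\right)}{-\ln\zeta}<\infty.$$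
   Context: A semigroup on $X$ is a family of (in general nonlinear) maps $S(t):X\to X$, $t\ge 0$, with $S(0)=\mathrm{Id}$ and $S(t+s)=S(t)S(s)$. A set $\mathcal{A}$ is invariant if $S(t)\mathcal{A}=\mathcal{A}$ for all $t\ge 0$. A global attractor is a maximal compact invariant set that attracts each bounded set $B\subset X$. The fractal dimension (capacity) of a compact set $\mathcal{A}\subset X$ is $\dim_f\mathcal{A}=\limsup_{\varepsilon\to0}\frac{\ln N_\varepsilon(\mathcal{A})}{-\ln\varepsilon}$, where $N_\varepsilon(\mathcal{A})$ is the minimum number of balls of $X$ of radius less than $\varepsilon$ needed to cover $\mathcal{A}$. "Projection" means a linear projection on $X$. *)

theory Defs
  imports "HOL-Analysis.Analysis"
begin

text \<open>Only the values \<open>S t\<close> with \<open>t \<ge> 0\<close> matter; no continuity is required.\<close>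

definition semigroup_maps :: "(real \<Rightarrow> 'a \<Rightarrow> 'a) \<Rightarrow> bool" where
  "semigroup_maps S \<longleftrightarrow>
     S 0 = id \<and> (\<forall>t\<ge>0. \<forall>s\<ge>0. S (t + s) = S t \<circ> S s)"

definition invariant_set :: "(real \<Rightarrow> 'a \<Rightarrow> 'a) \<Rightarrow> 'a set \<Rightarrow> bool" where
  "invariant_set S A \<longleftrightarrow> (\<forall>t\<ge>0. S t ` A = A)"

text \<open>
  The values lie in \<^typ>\<open>ennreal\<close>, so that the supremum over the empty set is \<open>0\<close> and the
  infimum over the empty set is \<open>\<infinity>\<close>. In particular the empty set attracts no nonempty set.
\<close>

definition hausdorff_semidist :: "'a::metric_space set \<Rightarrow> 'a set \<Rightarrow> ennreal" where
  "hausdorff_semidist B A = (SUP b\<in>B. INF a\<in>A. ennreal (dist b a))"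

definition attracts :: "(real \<Rightarrow> 'a::metric_space \<Rightarrow> 'a) \<Rightarrow> 'a set \<Rightarrow> 'a set \<Rightarrow> bool" where
  "attracts S A B \<longleftrightarrow> ((\<lambda>t. hausdorff_semidist (S t ` B) A) \<longlongrightarrow> 0) at_top"

definition global_attractor :: "(real \<Rightarrow> 'a::metric_space \<Rightarrow> 'a) \<Rightarrow> 'a set \<Rightarrow> bool" where
  "global_attractor S A \<longleftrightarrow>
     compact A \<and> invariant_set S A \<and>
     (\<forall>K. compact K \<and> invariant_set S K \<and> A \<subseteq> K \<longrightarrow> K = A) \<and>
     (\<forall>B. bounded B \<longrightarrow> attracts S A B)"

text \<open>A projection is linear and idempotent; boundedness is not part of the definition.\<close>

definition linear_projection :: "('a::real_vector \<Rightarrow> 'a) \<Rightarrow> bool" where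
  "linear_projection P \<longleftrightarrow> linear P \<and> P \<circ> P = P"

definition finite_rank :: "('a::real_vector \<Rightarrow> 'a) \<Rightarrow> bool" where
  "finite_rank P \<longleftrightarrow> (\<exists>B. finite B \<and> span B = range P)"

definition ball_cover :: "real \<Rightarrow> 'a::metric_space set \<Rightarrow> 'a set set \<Rightarrow> bool" where
  "ball_cover \<epsilon> A \<B> \<longleftrightarrow>
     (\<forall>U\<in>\<B>. \<exists>c r. 0 < r \<and> r < \<epsilon> \<and> U = ball c r) \<and> A \<subseteq> \<Union>\<B>"

text \<open>
  The centres range over the whole space. For compact \<open>A\<close> and \<open>\<epsilon> > 0\<close> a finite cover exists,
  so the infimum (over \<^typ>\<open>nat\<close>) is an attained minimum.
\<close>

definition covering_number :: "real \<Rightarrow> 'a::metric_space set \<Rightarrow> nat" where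
  "covering_number \<epsilon> A = Inf {card \<B> | \<B>. finite \<B> \<and> ball_cover \<epsilon> A \<B>}"

definition fractal_dim :: "'a::metric_space set \<Rightarrow> ereal" where
  "fractal_dim A =
     Limsup (at_right 0) (\<lambda>\<epsilon>. ereal (ln (real (covering_number \<epsilon> A)) / (- ln \<epsilon>)))"

end

theory Submission
  imports Defs "HOL-Real_Asymp.Real_Asymp"
begin

text \<open>
  Suppose that a piece \<open>U\<close> of the attractor has diameter at most \<open>d\<close>, and put \<open>E = exp (lam0 t0)\<close>.
  The projected image of \<open>U\<close> under \<open>S t0\<close> has diameter at most \<open>M1 E d\<close> and lies in a space of
  dimension \<open>\<Lambda>\<close>, so it splits into finitely many parts of diameter at most \<open>\<alpha> E d\<close>. On each part the
  complementary component varies by at most \<open>(M2 exp (lam1 t0) + M3 E) d\<close>; hence \<open>S t0 ` U\<close> splits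
  into that many pieces of diameter at most \<open>\<zeta> d\<close>. As the attractor equals its image under \<open>S t0\<close>,
  the argument can be iterated: with \<open>k\<close> parts in every step, the attractor is a union of \<open>k ^ n\<close>
  pieces of diameter \<open>\<zeta> ^ n d\<close>, and its fractal dimension is at most \<open>ln k / (- ln \<zeta>)\<close>.

  The pieces are measured by diameter and not by radius because the estimates hold only between
  points of the attractor. Centres of balls found in the range of the projection do not come from
  such points, and moving them into the attractor would double the radii in each step and spoil the
  rate \<open>\<zeta>\<close>.

  It remains to obtain \<open>k \<le> (2 + 2 M1 / \<alpha>) ^ \<Lambda>\<close>: a set of diameter \<open>D\<close> in dimension \<open>\<Lambda>\<close> has to be
  covered by \<open>(2 + 2 D / \<rho>) ^ \<Lambda>\<close> sets of diameter \<open>\<rho>\<close> (\<open>isodiametric_cover\<close>). In Euclidean space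
  this would be a consequence of the isodiametric inequality; in an arbitrary norm it follows by
  packing scaled copies of the convex hull of the set into the hull
  (\<open>isodiametric_separated_card_bound\<close>), and the volume comparison used there is replaced by iterating
  the packing at ever smaller scales (\<open>scaled_translates_card_bound\<close>).
\<close>

section \<open>Packing in finite-dimensional subspaces\<close>

text \<open>
  All norms on a finite-dimensional space are equivalent. The coefficient vectors in \<open>[-1, 1]\<close> with
  a fixed coefficient equal to \<open>1\<close> form a compact set on which the norm of the linear combination
  is positive, hence bounded below; scaling by the coefficient of largest modulus reduces every
  vector to this case.
\<close>

lemma coordinates_bounded_by_norm:
  fixes B :: "'a::real_normed_vector set"
  assumes fin: "finite B" and ind: "independent B"
  obtains M where "M > 0"
    "\<And>c b. b \<in> B \<Longrightarrow> \<bar>c b\<bar> \<le> M * norm (\<Sum>v\<in>B. c v *\<^sub>R v)"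
proof -
  define comb :: "('a \<Rightarrow> real) \<Rightarrow> 'a" where "comb c = (\<Sum>v\<in>B. c v *\<^sub>R v)" for c
  define K :: "'a \<Rightarrow> ('a \<Rightarrow> real) set" where
    "K b = PiE UNIV (\<lambda>v. if v = b then {1} else if v \<in> B then {-1..1} else {0})" for b
  have cont: "continuous_on X (\<lambda>c. norm (comb c))" for X
    unfolding comb_def
    by (intro continuous_intros continuous_on_product_coordinates[THEN continuous_on_subset]) auto
  have comp: "compact (K b)" for b
    unfolding K_def compactin_euclidean_iff[symmetric] euclidean_product_topology[symmetric]
      compactin_PiE
    by auto
  have ne: "(\<lambda>v. if v = b then 1 else 0) \<in> K b" for b
    by (auto simp: K_def)
  have "\<exists>m>0. \<forall>c\<in>K b. m \<le> norm (comb c)" if b: "b \<in> B" for b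
  proof -
    obtain c0 where c0: "c0 \<in> K b" "\<And>c. c \<in> K b \<Longrightarrow> norm (comb c0) \<le> norm (comb c)"
      using continuous_attains_inf[OF comp _ cont] ne by blast
    have "c0 b = 1" using c0(1) by (auto simp: K_def PiE_def Pi_def split: if_splits)
    then have "comb c0 \<noteq> 0"
      using ind b unfolding comb_def dependent_finite[OF fin] by (metis zero_neq_one)
    then show ?thesis using c0(2) by (intro exI[of _ "norm (comb c0)"]) auto
  qed
  then obtain m where m: "\<And>b. b \<in> B \<Longrightarrow> m b > 0"
    "\<And>b c. b \<in> B \<Longrightarrow> c \<in> K b \<Longrightarrow> m b \<le> norm (comb c)" by metis
  define M where "M = 1 + (\<Sum>b\<in>B. 1 / m b)"
  have inv_le: "1 / m b \<le> M" if "b \<in> B" for b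
    unfolding M_def using member_le_sum[of b B "\<lambda>b. 1 / m b"] that fin m(1)
    by (smt (verit) divide_nonneg_nonneg less_eq_real_def member_le_sum DiffD1)
  have Mpos: "M > 0" unfolding M_def using m(1)
    by (smt (verit) sum_nonneg zero_le_divide_1_iff)
  have "\<bar>c b\<bar> \<le> M * norm (comb c)" if b: "b \<in> B" for c b
  proof -
    have "Max ((\<lambda>v. \<bar>c v\<bar>) ` B) \<in> (\<lambda>v. \<bar>c v\<bar>) ` B"
      using fin b by (intro Max_in) auto
    then obtain j where "j \<in> B" "\<bar>c j\<bar> = Max ((\<lambda>v. \<bar>c v\<bar>) ` B)" by force
    then have j: "j \<in> B" "\<And>v. v \<in> B \<Longrightarrow> \<bar>c v\<bar> \<le> \<bar>c j\<bar>"
      using fin by auto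
    show ?thesis
    proof (cases "c j = 0")
      case True
      then show ?thesis using j(2)[OF b] Mpos by simp
    next
      case False
      define d where "d v = (if v \<in> B then c v / c j else 0)" for v
      \<comment> \<open>normalise by the largest coefficient, so that the combination falls into \<open>K j\<close>\<close>
      have "\<bar>d v\<bar> \<le> 1" if "v \<in> B" for v
        using j(2)[OF that] that False by (simp add: d_def abs_divide)
      then have "d v \<in> {-1..1}" if "v \<in> B" for v
        using that by (simp add: abs_le_iff minus_le_iff)
      moreover have "d j = 1" "\<And>v. v \<notin> B \<Longrightarrow> d v = 0"
        using False j(1) by (auto simp: d_def)
      ultimately have "d \<in> K j" by (auto simp: K_def PiE_def)
      then have "m j \<le> norm (comb d)" using m(2) j(1) by blast
      also have "comb d = (1 / c j) *\<^sub>R comb c"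
        by (simp add: comb_def d_def scaleR_sum_right)
      finally have "m j * \<bar>c j\<bar> \<le> norm (comb c)"
        using False by (simp add: field_simps)
      then have "\<bar>c j\<bar> \<le> (1 / m j) * norm (comb c)"
        using m(1)[OF j(1)] by (simp add: field_simps)
      also have "\<dots> \<le> M * norm (comb c)"
        using inv_le[OF j(1)] by (intro mult_right_mono) auto
      finally show ?thesis using j(2)[OF b] by linarith
    qed
  qed
  then show ?thesis using that Mpos unfolding comb_def by blast
qed

text \<open>
  In coordinates, distinct points of an \<open>s\<close>-separated set lie in distinct cells of a grid of mesh
  proportional to \<open>s\<close>. The constant obtained is far from sharp; only the exponent, which is the
  dimension, matters below.
\<close>

lemma separated_subset_card_bound:
  fixes B :: "'a::real_normed_vector set"
  assumes fin: "finite B" and ind: "independent B"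
  obtains c :: real where "c > 0"
    "\<And>s T. \<lbrakk>0 < s; s \<le> 1; finite T; T \<subseteq> span B; T \<subseteq> cball 0 R; 
        \<And>x y. x \<in> T \<Longrightarrow> y \<in> T \<Longrightarrow> x \<noteq> y \<Longrightarrow> s \<le> dist x y\<rbrakk>
      \<Longrightarrow> real (card T) \<le> (c / s) ^ card B"
proof -
  obtain M where M: "M > 0"
    "\<And>c b. b \<in> B \<Longrightarrow> \<bar>c b\<bar> \<le> M * norm (\<Sum>v\<in>B. c v *\<^sub>R v)"
    using coordinates_bounded_by_norm[OF fin ind] by metis
  define L where "L = (\<Sum>b\<in>B. norm b) + 1"
  have L: "L > 0" unfolding L_def by (smt (verit) norm_ge_zero sum_nonneg)
  define c where "c = 2 * (M * \<bar>R\<bar> * L) + 3"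
  have c: "c > 0" unfolding c_def using M L by (intro add_nonneg_pos) auto
  let ?r = "representation B"
  have rep: "(\<Sum>v\<in>B. ?r x v *\<^sub>R v) = x" if "x \<in> span B" for x
    using sum_representation_eq[OF ind that fin] by simp
  have "real (card T) \<le> (c / s) ^ card B"
    if s: "0 < s" "s \<le> 1" and T: "finite T" "T \<subseteq> span B" "T \<subseteq> cball 0 R"
      and sep: "\<And>x y. x \<in> T \<Longrightarrow> y \<in> T \<Longrightarrow> x \<noteq> y \<Longrightarrow> s \<le> dist x y" for s T
  proof -
    \<comment> \<open>coefficients that agree up to \<open>h\<close> give vectors closer than \<open>s\<close>,
      as \<open>L\<close> exceeds the sum of the basis norms\<close>
    define h where "h = s / L"
    have h: "h > 0" using s L by (simp add: h_def)
    define Y where "Y = M * \<bar>R\<bar> / h"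
    have Y: "Y \<ge> 0" using M h by (simp add: Y_def)
    define cell where "cell x = (\<lambda>b\<in>B. \<lfloor>?r x b / h\<rfloor>)" for x
    have cells: "cell ` T \<subseteq> PiE B (\<lambda>_. {- \<lceil>Y\<rceil>..\<lceil>Y\<rceil>})"
    proof (clarsimp simp: cell_def restrict_PiE_iff)
      fix x b assume x: "x \<in> T" and b: "b \<in> B"
      have "\<bar>?r x b\<bar> \<le> M * norm x"
        using M(2)[OF b, of "?r x"] rep x T(2) by (metis subsetD)
      also have "\<dots> \<le> M * \<bar>R\<bar>"
        using x T(3) M(1) by (intro mult_left_mono) (auto simp: subset_iff)
      finally have "\<bar>?r x b / h\<bar> \<le> Y"
        using h by (simp add: Y_def abs_divide divide_right_mono)
      then show "- \<lceil>Y\<rceil> \<le> \<lfloor>?r x b / h\<rfloor> \<and> \<lfloor>?r x b / h\<rfloor> \<le> \<lceil>Y\<rceil>"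
        by linarith
    qed
    have inj: "inj_on cell T"
    proof (rule inj_onI, rule ccontr)
      fix x y assume xy: "x \<in> T" "y \<in> T" "cell x = cell y" "x \<noteq> y"
      have close: "\<bar>?r x b - ?r y b\<bar> \<le> h" if b: "b \<in> B" for b
      proof -
        have "\<lfloor>?r x b / h\<rfloor> = \<lfloor>?r y b / h\<rfloor>"
          using fun_cong[OF xy(3), of b] b by (simp add: cell_def)
        then have "\<bar>?r x b / h - ?r y b / h\<bar> \<le> 1" by linarith
        then show ?thesis
          using h by (simp add: abs_divide diff_divide_distrib[symmetric])
      qed
      have "dist x y = norm (\<Sum>b\<in>B. (?r x b - ?r y b) *\<^sub>R b)"
        using rep xy T(2)
        by (simp add: dist_norm scaleR_diff_left sum_subtractf subset_iff)
      also have "\<dots> \<le> (\<Sum>b\<in>B. h * norm b)"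
        by (rule order_trans[OF norm_sum], rule sum_mono) (use close in \<open>auto intro: mult_right_mono\<close>)
      also have "\<dots> = h * (L - 1)" by (simp add: L_def sum_distrib_left)
      also have "\<dots> < s" using h s L by (simp add: h_def field_simps)
      finally show False using sep[of x y] xy by simp
    qed
    have "card T \<le> card (PiE B (\<lambda>_. {- \<lceil>Y\<rceil>..\<lceil>Y\<rceil>}))"
      using card_inj_on_le[OF inj cells] fin by (auto intro: finite_PiE)
    also have "\<dots> = nat (2 * \<lceil>Y\<rceil> + 1) ^ card B"
      using fin by (simp add: card_PiE mult_2 algebra_simps)
    finally have "real (card T) \<le> real (nat (2 * \<lceil>Y\<rceil> + 1)) ^ card B"
      by (metis of_nat_le_iff of_nat_power)
    also have "\<dots> \<le> (c / s) ^ card B"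
    proof (rule power_mono)
      have "real (nat (2 * \<lceil>Y\<rceil> + 1)) \<le> 2 * Y + 3" using Y by linarith
      also have "2 * Y + 3 \<le> 2 * Y + 3 / s" using s by (simp add: field_simps)
      also have "\<dots> = c / s"
        using s L by (simp add: Y_def h_def c_def field_simps)
      finally show "real (nat (2 * \<lceil>Y\<rceil> + 1)) \<le> c / s" .
    qed simp
    finally show ?thesis .
  qed
  then show ?thesis using that c by blast
qed


text \<open>
  This is the volume comparison \<open>card T * \<eta> ^ dim * vol C \<le> vol C\<close>, proved without a measure.
  A packing of \<open>C\<close> by copies of \<open>\<eta> C\<close> can be repeated inside each copy, so \<open>C\<close> contains
  \<open>card T ^ m\<close> disjoint copies of \<open>\<eta> ^ m C\<close> for every \<open>m\<close>. The copies of an interior point are then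
  separated at scale \<open>\<eta> ^ m\<close>, so a crude packing bound gives \<open>(card T * \<eta> ^ dim) ^ m \<le> const\<close>;
  letting \<open>m\<close> grow removes the constant.
\<close>

lemma scaled_translates_card_bound:
  fixes B C T :: "'a::real_normed_vector set" and \<eta> r :: real
  assumes fin: "finite B" and ind: "independent B"
    and C: "C \<subseteq> span B" "bounded C"
    and p: "p \<in> C" and r: "r > 0"
    and inner: "\<And>x. x \<in> span B \<Longrightarrow> dist x p < r \<Longrightarrow> x \<in> C"
    and \<eta>: "0 < \<eta>" "\<eta> < 1"
    and T: "finite T" "T \<subseteq> span B"
    and inside: "\<And>w c. w \<in> T \<Longrightarrow> c \<in> C \<Longrightarrow> w + \<eta> *\<^sub>R c \<in> C"
    and disj: "\<And>w w' c c'. \<lbrakk>w \<in> T; w' \<in> T; c \<in> C; c' \<in> C; w + \<eta> *\<^sub>R c = w' + \<eta> *\<^sub>R c'\<rbrakk> \<Longrightarrow> w = w'"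
  shows "real (card T) \<le> (1 / \<eta>) ^ card B"
proof -
  define packs where "packs m X \<longleftrightarrow> finite X \<and> X \<subseteq> span B \<and> card X = card T ^ m \<and>
      (\<forall>w\<in>X. \<forall>c\<in>C. w + \<eta> ^ m *\<^sub>R c \<in> C) \<and>
      (\<forall>w\<in>X. \<forall>w'\<in>X. \<forall>c\<in>C. \<forall>c'\<in>C. w + \<eta> ^ m *\<^sub>R c = w' + \<eta> ^ m *\<^sub>R c' \<longrightarrow> w = w')" for m X
  have packs_uniq: "w = w'"
    if "packs m X" "w \<in> X" "w' \<in> X" "c \<in> C" "c' \<in> C"
      and "w + \<eta> ^ m *\<^sub>R c = w' + \<eta> ^ m *\<^sub>R c'" for m X w w' c c'
    using that unfolding packs_def by blast
  have "\<exists>X. packs m X" for m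
  proof (induction m)
    case 0
    have "packs 0 {0}" by (simp add: packs_def span_zero)
    then show ?case by blast
  next
    case (Suc m)
    then obtain X where X: "packs m X" ..
    let ?f = "\<lambda>(w, v). w + \<eta> *\<^sub>R v"
    have eq: "w + \<eta> *\<^sub>R v + \<eta> ^ Suc m *\<^sub>R c = w + \<eta> *\<^sub>R (v + \<eta> ^ m *\<^sub>R c)" for w v c :: 'a
      by (simp add: scaleR_add_right add.assoc)
    have uniq: "w = w' \<and> v = v'"
      if "w \<in> T" "w' \<in> T" "v \<in> X" "v' \<in> X" "c \<in> C" "c' \<in> C"
        and e: "w + \<eta> *\<^sub>R v + \<eta> ^ Suc m *\<^sub>R c = w' + \<eta> *\<^sub>R v' + \<eta> ^ Suc m *\<^sub>R c'"
      for w w' v v' c c'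
    proof -
      have in_C: "v + \<eta> ^ m *\<^sub>R c \<in> C" "v' + \<eta> ^ m *\<^sub>R c' \<in> C"
        using X that by (auto simp: packs_def)
      have "w = w'" using disj[OF that(1,2) in_C] e unfolding eq by simp
      moreover from this have "v + \<eta> ^ m *\<^sub>R c = v' + \<eta> ^ m *\<^sub>R c'"
        using e \<eta> unfolding eq by simp
      ultimately show ?thesis using packs_uniq[OF X that(3-6)] by blast
    qed
    have inj: "inj_on ?f (T \<times> X)"
      using uniq[OF _ _ _ _ p p] by (auto intro!: inj_onI)
    have "packs (Suc m) (?f ` (T \<times> X))"
      unfolding packs_def
    proof (intro conjI)
      show "finite (?f ` (T \<times> X))" using T X by (simp add: packs_def)
      show "?f ` (T \<times> X) \<subseteq> span B"
        using T X by (auto simp: packs_def intro!: span_add span_scale)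
      show "card (?f ` (T \<times> X)) = card T ^ Suc m"
        using card_image[OF inj] X by (simp add: packs_def card_cartesian_product)
      show "\<forall>w\<in>?f ` (T \<times> X). \<forall>c\<in>C. w + \<eta> ^ Suc m *\<^sub>R c \<in> C"
      proof (intro ballI)
        fix u c assume "u \<in> ?f ` (T \<times> X)" and c: "c \<in> C"
        then obtain w v where u: "u = w + \<eta> *\<^sub>R v" "w \<in> T" "v \<in> X" by auto
        then have "v + \<eta> ^ m *\<^sub>R c \<in> C" using X c by (auto simp: packs_def)
        then show "u + \<eta> ^ Suc m *\<^sub>R c \<in> C" unfolding u(1) eq by (rule inside[OF u(2)])
      qed
      show "\<forall>w\<in>?f ` (T \<times> X). \<forall>w'\<in>?f ` (T \<times> X). \<forall>c\<in>C. \<forall>c'\<in>C.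
          w + \<eta> ^ Suc m *\<^sub>R c = w' + \<eta> ^ Suc m *\<^sub>R c' \<longrightarrow> w = w'"
      proof (intro ballI impI)
        fix u u' c c'
        assume "u \<in> ?f ` (T \<times> X)" "u' \<in> ?f ` (T \<times> X)" and c: "c \<in> C" "c' \<in> C"
          and e: "u + \<eta> ^ Suc m *\<^sub>R c = u' + \<eta> ^ Suc m *\<^sub>R c'"
        then obtain w v w' v' where u: "u = w + \<eta> *\<^sub>R v" "w \<in> T" "v \<in> X"
          and u': "u' = w' + \<eta> *\<^sub>R v'" "w' \<in> T" "v' \<in> X" by auto
        show "u = u'"
          using uniq[OF u(2) u'(2) u(3) u'(3) c] e unfolding u(1) u'(1) by simp
      qed
    qed
    then show ?case by blast
  qed
  then obtain X where X: "\<And>m. packs m (X m)" by metis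
  obtain R where R: "C \<subseteq> cball 0 R"
    using C(2) unfolding bounded_iff by (auto simp: subset_iff)
  obtain k where k: "k > 0"
    "\<And>s T. \<lbrakk>0 < s; s \<le> 1; finite T; T \<subseteq> span B; T \<subseteq> cball 0 R; 
        \<And>x y. x \<in> T \<Longrightarrow> y \<in> T \<Longrightarrow> x \<noteq> y \<Longrightarrow> s \<le> dist x y\<rbrakk>
      \<Longrightarrow> real (card T) \<le> (k / s) ^ card B"
    using separated_subset_card_bound[OF fin ind, of R] by metis
  define r' where "r' = min r 1"
  have r': "0 < r'" "r' \<le> 1" "r' \<le> r" using r by (auto simp: r'_def)
  have bound: "(real (card T) * \<eta> ^ card B) ^ m \<le> (k / r') ^ card B" for m
  proof -
    have \<eta>m: "0 < \<eta> ^ m" "\<eta> ^ m \<le> 1" using \<eta> by (auto intro: power_le_one)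
    let ?g = "\<lambda>w. w + \<eta> ^ m *\<^sub>R p"
    have sub: "?g ` X m \<subseteq> C" using X[of m] p by (auto simp: packs_def)
    have sep: "r' * \<eta> ^ m \<le> dist x y" if x: "x \<in> ?g ` X m" and y: "y \<in> ?g ` X m" and "x \<noteq> y" for x y
    proof (rule ccontr)
      assume "\<not> r' * \<eta> ^ m \<le> dist x y"
      then have less: "dist x y < r * \<eta> ^ m"
        using mult_right_mono[OF r'(3), of "\<eta> ^ m"] \<eta>m by linarith
      obtain w w' where w: "w \<in> X m" "x = ?g w" and w': "w' \<in> X m" "y = ?g w'" using x y by auto
      \<comment> \<open>the translate at \<open>w'\<close> would contain the image of \<open>p\<close> under the translate at \<open>w\<close>\<close>
      let ?q = "p + (1 / \<eta> ^ m) *\<^sub>R (w - w')"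
      have "w \<in> span B" "w' \<in> span B" "p \<in> span B"
        using X[of m] w w' p C by (auto simp: packs_def)
      then have "?q \<in> span B" by (intro span_add span_scale span_diff)
      moreover have "dist ?q p < r"
      proof -
        have "dist ?q p = norm (w - w') / \<eta> ^ m"
          using \<eta>m by (simp add: dist_norm del: scaleR_right_diff_distrib)
        then show ?thesis using less \<eta>m w w' by (simp add: dist_norm divide_less_eq)
      qed
      ultimately have q: "?q \<in> C" by (rule inner)
      have "w + \<eta> ^ m *\<^sub>R p = w' + \<eta> ^ m *\<^sub>R ?q"
        using \<eta> by (simp add: scaleR_add_right)
      then have "w = w'" by (rule packs_uniq[OF X w(1) w'(1) p q])
      then show False using \<open>x \<noteq> y\<close> w w' by simp
    qed
    have "real (card (?g ` X m)) \<le> (k / (r' * \<eta> ^ m)) ^ card B"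
    proof (rule k(2))
      show "r' * \<eta> ^ m \<le> 1" using r' \<eta>m by (simp add: mult_le_one)
      show "0 < r' * \<eta> ^ m" using r' \<eta>m by simp
      show "finite (?g ` X m)" using X[of m] by (simp add: packs_def)
          show "?g ` X m \<subseteq> span B" "?g ` X m \<subseteq> cball 0 R" using sub C(1) R by auto
    qed (rule sep)
    moreover have "card (?g ` X m) = card T ^ m"
      using X[of m] by (subst card_image) (auto simp: packs_def inj_on_def)
    ultimately have "real (card T) ^ m \<le> (k / (r' * \<eta> ^ m)) ^ card B" by simp
    also have "\<dots> = (k / r') ^ card B / (\<eta> ^ card B) ^ m"
      by (simp add: power_divide power_mult_distrib power_mult[symmetric] mult.commute)
    finally have le: "real (card T) ^ m \<le> (k / r') ^ card B / (\<eta> ^ card B) ^ m" .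
    have "0 < (\<eta> ^ card B) ^ m" using \<eta> by simp
    from iffD1[OF pos_le_divide_eq[OF this] le] show ?thesis by (simp add: power_mult_distrib)
  qed
  have "real (card T) * \<eta> ^ card B \<le> 1"
  proof (rule ccontr)
    assume "\<not> real (card T) * \<eta> ^ card B \<le> 1"
    then obtain m where "(k / r') ^ card B < (real (card T) * \<eta> ^ card B) ^ m"
      using real_arch_pow[of "real (card T) * \<eta> ^ card B" "(k / r') ^ card B"] by auto
    then show False using bound[of m] by simp
  qed
  then show ?thesis using \<eta> by (simp add: power_divide field_simps)
qed

text \<open>
  Comparing balls around the points with a ball of radius \<open>D\<close> would give only the base \<open>1 + 4 D / \<rho>\<close>,
  since a set of diameter \<open>D\<close> need not lie in a ball of radius \<open>D / 2\<close>. The balls are therefore replaced by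
  scaled copies of the convex hull of \<open>T\<close> itself: two copies of a set of diameter \<open>\<rho> / 2\<close> whose
  translation vectors are more than \<open>\<rho> / 2\<close> apart are disjoint, and by convexity all these copies
  stay in a slightly enlarged hull.
\<close>

lemma isodiametric_separated_card_bound:
  fixes B T :: "'a::real_normed_vector set" and D \<rho> :: real
  assumes fin: "finite B" and ind: "independent B"
    and T: "finite T" "T \<subseteq> span B"
    and \<rho>: "\<rho> > 0" and D: "D \<ge> 0"
    and diam: "\<And>x y. x \<in> T \<Longrightarrow> y \<in> T \<Longrightarrow> dist x y \<le> D"
    and sep: "\<And>x y. x \<in> T \<Longrightarrow> y \<in> T \<Longrightarrow> x \<noteq> y \<Longrightarrow> \<rho> / 2 < dist x y"
  shows "real (card T) \<le> (2 + 2 * D / \<rho>) ^ card B"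
proof (cases "T = {}")
  case True
  then show ?thesis using \<rho> D by simp
next
  case False
  then obtain p where p: "p \<in> T" by blast
  \<comment> \<open>thickening the hull by \<open>\<rho> / 4\<close> provides interior points
    and turns the base \<open>1 + 2 D / \<rho>\<close> into \<open>2 + 2 D / \<rho>\<close>\<close>
  define N where "N = {b \<in> span B. norm b \<le> \<rho> / 4}"
  define C where "C = {a + b |a b. a \<in> convex hull T \<and> b \<in> N}"
  have "N = span B \<inter> cball 0 (\<rho> / 4)" by (auto simp: N_def)
  then have "convex N" by (simp add: convex_Int subspace_imp_convex)
  moreover have "C = (\<Union>a\<in>convex hull T. \<Union>b\<in>N. {a + b})" by (auto simp: C_def)
  ultimately have convex: "convex C"
    using convex_sums[OF convex_convex_hull] by metis
  have hull_span: "convex hull T \<subseteq> span B"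
    by (rule hull_minimal) (use T in \<open>auto simp: subspace_imp_convex\<close>)
  have C_span: "C \<subseteq> span B"
    using hull_span by (auto simp: C_def N_def intro: span_add)
  have hull_diam: "dist x y \<le> D" if "x \<in> convex hull T" "y \<in> convex hull T" for x y
  proof -
    have *: "convex hull T \<subseteq> cball z D" if "T \<subseteq> cball z D" for z
      by (rule hull_minimal) (use that in auto)
    have "convex hull T \<subseteq> cball z D" if "z \<in> T" for z
      using diam that by (intro *) auto
    then have "T \<subseteq> cball x D" using that(1) by (auto simp: dist_commute subset_iff)
    then show ?thesis using *[of x] that(2) by (auto simp: subset_iff)
  qed
  define E where "E = D + \<rho> / 2"
  have E: "E > 0" using \<rho> D by (simp add: E_def)
  have C_diam: "norm (x - y) \<le> E" if x: "x \<in> C" and y: "y \<in> C" for x y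
  proof -
    obtain a b where ab: "x = a + b" "a \<in> convex hull T" "b \<in> N"
      using x unfolding C_def by blast
    obtain a' b' where ab': "y = a' + b'" "a' \<in> convex hull T" "b' \<in> N"
      using y unfolding C_def by blast
    then have b: "norm b \<le> \<rho> / 4" "norm b' \<le> \<rho> / 4"
      using ab ab' by (simp_all add: N_def)
    have "norm (x - y) \<le> norm (a - a') + (norm b + norm b')"
      unfolding ab(1) ab'(1) add_diff_add
      using norm_triangle_ineq[of "a - a'" "b - b'"] norm_triangle_ineq4[of b b'] by linarith
    then show ?thesis using hull_diam[OF ab(2) ab'(2)] b by (simp add: E_def dist_norm)
  qed
  have T_C: "T \<subseteq> C"
    using \<rho> hull_subset[of T convex] by (force simp: C_def N_def span_zero)
  \<comment> \<open>\<open>\<theta> C\<close> has diameter at most \<open>\<rho> / 2\<close>, and its translates by points of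
    \<open>T\<close> lie in \<open>(1 + \<theta>) C\<close>; dividing by \<open>1 + \<theta>\<close> puts copies of \<open>\<eta> C\<close> into \<open>C\<close>\<close>
  define \<theta> where "\<theta> = \<rho> / (2 * E)"
  have \<theta>: "\<theta> > 0" using \<rho> E by (simp add: \<theta>_def)
  define \<eta> where "\<eta> = \<theta> / (1 + \<theta>)"
  have \<eta>: "0 < \<eta>" "\<eta> < 1" using \<theta> by (auto simp: \<eta>_def)
  define T' where "T' = (\<lambda>w. (1 / (1 + \<theta>)) *\<^sub>R w) ` T"
  have card: "card T' = card T"
    unfolding T'_def using \<theta> by (intro card_image) (auto simp: inj_on_def)
  have "real (card T') \<le> (1 / \<eta>) ^ card B"
  proof (rule scaled_translates_card_bound[OF fin ind C_span _ _ _ _ \<eta>])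
    show "bounded C"
      unfolding bounded_two_points using C_diam by (auto simp: dist_norm)
    show "p \<in> C" using p T_C by blast
    show "\<rho> / 4 > 0" using \<rho> by simp
    show "x \<in> C" if "x \<in> span B" "dist x p < \<rho> / 4" for x
    proof -
      have "x - p \<in> N" using that p T by (auto simp: N_def dist_norm intro: span_diff)
      moreover have "p \<in> convex hull T" using p by (rule hull_inc)
      ultimately show ?thesis
        unfolding C_def by (smt (verit) add.commute diff_add_cancel mem_Collect_eq)
    qed
    show "finite T'" "T' \<subseteq> span B" using T by (auto simp: T'_def intro: span_scale)
    show "w + \<eta> *\<^sub>R c \<in> C" if w: "w \<in> T'" and c: "c \<in> C" for w c
    proof -
      obtain v where v: "v \<in> T" "w = (1 / (1 + \<theta>)) *\<^sub>R v" using w by (auto simp: T'_def)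
      have "(1 / (1 + \<theta>)) *\<^sub>R v + \<eta> *\<^sub>R c \<in> C"
        by (rule convexD[OF convex]) (use v T_C c \<theta> in \<open>auto simp: \<eta>_def field_simps\<close>)
      then show ?thesis using v by simp
    qed
    show "w = w'" if w: "w \<in> T'" "w' \<in> T'" and c: "c \<in> C" "c' \<in> C"
      and eq: "w + \<eta> *\<^sub>R c = w' + \<eta> *\<^sub>R c'" for w w' c c'
    proof -
      obtain v v' where v: "v \<in> T" "w = (1 / (1 + \<theta>)) *\<^sub>R v"
        and v': "v' \<in> T" "w' = (1 / (1 + \<theta>)) *\<^sub>R v'" using w by (auto simp: T'_def)
      have \<eta>_alt: "\<eta> = (1 / (1 + \<theta>)) * \<theta>" by (simp add: \<eta>_def)
      have "(1 / (1 + \<theta>)) *\<^sub>R (v + \<theta> *\<^sub>R c) = (1 / (1 + \<theta>)) *\<^sub>R (v' + \<theta> *\<^sub>R c')"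
        using eq unfolding v v' \<eta>_alt by (simp only: scaleR_add_right scaleR_scaleR)
      then have "v + \<theta> *\<^sub>R c = v' + \<theta> *\<^sub>R c'" using \<theta> by simp
      then have "v - v' = \<theta> *\<^sub>R (c' - c)" by (simp add: algebra_simps)
      then have "dist v v' = \<theta> * norm (c' - c)" using \<theta> by (simp add: dist_norm)
      also have "\<dots> \<le> \<theta> * E" using C_diam c \<theta> by (intro mult_left_mono) auto
      also have "\<dots> = \<rho> / 2" using E by (simp add: \<theta>_def)
      finally have "v = v'" using sep[OF v(1) v'(1)] by force
      then show ?thesis using v v' by simp
    qed
  qed
  also have "1 / \<eta> = 2 + 2 * D / \<rho>"
  proof -
    have "1 / \<eta> = 1 + 1 / \<theta>" using \<theta> by (simp add: \<eta>_def field_simps)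
    also have "1 / \<theta> = 1 + 2 * D / \<rho>" using \<rho> by (simp add: \<theta>_def E_def field_simps)
    finally show ?thesis by simp
  qed
  finally show ?thesis using card by simp
qed

text \<open>
  A maximal \<open>\<rho> / 2\<close>-separated subset is a \<open>\<rho> / 2\<close>-net.
\<close>

lemma isodiametric_cover:
  fixes B W :: "'a::real_normed_vector set" and D \<rho> :: real
  assumes fin: "finite B" and ind: "independent B"
    and W: "W \<subseteq> span B"
    and \<rho>: "\<rho> > 0" and D: "D \<ge> 0"
    and diam: "\<And>x y. x \<in> W \<Longrightarrow> y \<in> W \<Longrightarrow> dist x y \<le> D"
  obtains T where "finite T" "real (card T) \<le> (2 + 2 * D / \<rho>) ^ card B"
    "W \<subseteq> (\<Union>w\<in>T. cball w (\<rho> / 2))"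
proof -
  define sep where "sep T \<longleftrightarrow> finite T \<and> T \<subseteq> W \<and>
    (\<forall>x\<in>T. \<forall>y\<in>T. x \<noteq> y \<longrightarrow> \<rho> / 2 < dist x y)" for T
  have bound: "real (card T) \<le> (2 + 2 * D / \<rho>) ^ card B" if "sep T" for T
    using that W diam
    by (intro isodiametric_separated_card_bound[OF fin ind _ _ \<rho> D]) (auto simp: sep_def)
  have "sep {}" by (simp add: sep_def)
  moreover have "\<forall>T. sep T \<longrightarrow> card T < Suc (nat \<lceil>(2 + 2 * D / \<rho>) ^ card B\<rceil>)"
    using bound by (smt (verit) less_Suc_eq_le of_nat_le_iff real_nat_ceiling_ge)
  ultimately obtain T where T: "sep T" "\<And>T'. sep T' \<Longrightarrow> card T' \<le> card T"
    using ex_has_greatest_nat[of sep "{}" card] by blast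
  have "W \<subseteq> (\<Union>w\<in>T. cball w (\<rho> / 2))"
  proof (rule subsetI, rule ccontr)
    fix x assume x: "x \<in> W" "x \<notin> (\<Union>w\<in>T. cball w (\<rho> / 2))"
    then have far: "\<rho> / 2 < dist w x" "\<rho> / 2 < dist x w" if "w \<in> T" for w
      using that by (auto simp: not_le dist_commute)
    then have "x \<notin> T" using \<rho> by force
    moreover have "sep (insert x T)" using T(1) x(1) far by (auto simp: sep_def)
    ultimately show False using T(2)[of "insert x T"] T(1) by (auto simp: sep_def)
  qed
  then show ?thesis using that bound[OF T(1)] T(1) by (auto simp: sep_def)
qed

section \<open>Covers by sets of small diameter\<close>

text \<open>
  The pieces are required to form the set exactly, not just to cover it: each piece then consists of
  points at which the squeezing estimates are available.
\<close>

definition diam_cover :: "real \<Rightarrow> nat \<Rightarrow> 'a::metric_space set \<Rightarrow> bool" where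
  "diam_cover d n A \<longleftrightarrow> (\<exists>\<U>. finite \<U> \<and> card \<U> \<le> n \<and> A = \<Union>\<U> \<and>
     (\<forall>U\<in>\<U>. \<forall>x\<in>U. \<forall>y\<in>U. dist x y \<le> d))"

lemma diam_cover_UN:
  assumes "finite I" "card I \<le> n" "A = (\<Union>i\<in>I. F i)"
    "\<And>i x y. i \<in> I \<Longrightarrow> x \<in> F i \<Longrightarrow> y \<in> F i \<Longrightarrow> dist x y \<le> d"
  shows "diam_cover d n A"
  unfolding diam_cover_def
  using assms card_image_le[of I F] by (intro exI[of _ "F ` I"]) auto

lemma diam_cover_image:
  assumes A: "diam_cover d n A"
    and step: "\<And>U. \<lbrakk>U \<subseteq> A; \<And>x y. x \<in> U \<Longrightarrow> y \<in> U \<Longrightarrow> dist x y \<le> d\<rbrakk> \<Longrightarrow> diam_cover d' k (f ` U)"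
  shows "diam_cover d' (k * n) (f ` A)"
proof -
  obtain \<U> where \<U>: "finite \<U>" "card \<U> \<le> n" "A = \<Union>\<U>"
    "\<And>U x y. U \<in> \<U> \<Longrightarrow> x \<in> U \<Longrightarrow> y \<in> U \<Longrightarrow> dist x y \<le> d"
    using A unfolding diam_cover_def by metis
  have "diam_cover d' k (f ` U)" if "U \<in> \<U>" for U
    using step[of U] \<U> that by blast
  then obtain G where G: "\<And>U. U \<in> \<U> \<Longrightarrow> finite (G U) \<and> card (G U) \<le> k \<and> f ` U = \<Union>(G U) \<and>
     (\<forall>V\<in>G U. \<forall>x\<in>V. \<forall>y\<in>V. dist x y \<le> d')"
    unfolding diam_cover_def by metis
  have "card (\<Union>U\<in>\<U>. G U) \<le> (\<Sum>U\<in>\<U>. card (G U))" by (rule card_UN_le[OF \<U>(1)])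
  also have "\<dots> \<le> card \<U> * k" using sum_bounded_above[of \<U> "\<lambda>U. card (G U)" k] G by auto
  also have "\<dots> \<le> k * n" using \<U>(2) by (simp add: mult.commute)
  finally have "card (\<Union>U\<in>\<U>. G U) \<le> k * n" .
  moreover have "f ` A = \<Union>(\<Union>U\<in>\<U>. G U)"
  proof -
    have "f ` A = (\<Union>U\<in>\<U>. f ` U)" unfolding \<U>(3) by blast
    also have "\<dots> = (\<Union>U\<in>\<U>. \<Union>(G U))" using G by simp
    also have "\<dots> = \<Union>(\<Union>U\<in>\<U>. G U)" by blast
    finally show ?thesis .
  qed
  moreover have "finite (\<Union>U\<in>\<U>. G U)" using \<U>(1) G by blast
  moreover have "\<forall>V\<in>(\<Union>U\<in>\<U>. G U). \<forall>x\<in>V. \<forall>y\<in>V. dist x y \<le> d'" using G by blast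
  ultimately show ?thesis unfolding diam_cover_def by blast
qed

text \<open>
  A nonempty set of diameter at most \<open>d\<close> lies in any ball of radius larger than \<open>d\<close> centred at one of
  its points; the loss of a factor against the radius does not affect the dimension.
\<close>

lemma covering_number_le_of_diam_cover:
  fixes A :: "'a::metric_space set"
  assumes A: "diam_cover d n A" and d: "0 \<le> d" "d < \<epsilon>"
  shows "covering_number \<epsilon> A \<le> n"
proof -
  obtain \<U> where \<U>: "finite \<U>" "card \<U> \<le> n" "A = \<Union>\<U>"
    "\<And>U x y. U \<in> \<U> \<Longrightarrow> x \<in> U \<Longrightarrow> y \<in> U \<Longrightarrow> dist x y \<le> d"
    using A unfolding diam_cover_def by metis
  obtain r where r: "d < r" "r < \<epsilon>" using dense[OF d(2)] by blast
  define \<B> where "\<B> = (\<lambda>U. ball (SOME x. x \<in> U) r) ` \<U>"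
  have "A \<subseteq> \<Union>\<B>"
  proof
    fix x assume "x \<in> A"
    then obtain U where U: "x \<in> U" "U \<in> \<U>" using \<U>(3) by blast
    then have "(SOME x. x \<in> U) \<in> U" by (metis someI)
    then have "x \<in> ball (SOME x. x \<in> U) r" using \<U>(4)[OF U(2) _ U(1)] r by fastforce
    then show "x \<in> \<Union>\<B>" using U(2) by (auto simp: \<B>_def)
  qed
  moreover have "\<exists>c r. 0 < r \<and> r < \<epsilon> \<and> U = ball c r" if U: "U \<in> \<B>" for U
  proof -
    obtain c where "U = ball c r" using U by (auto simp: \<B>_def)
    moreover have "0 < r" using d r by linarith
    ultimately show ?thesis using r by blast
  qed
  ultimately have "ball_cover \<epsilon> A \<B>" "finite \<B>"
    using \<U>(1) by (auto simp: ball_cover_def \<B>_def)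
  then have "covering_number \<epsilon> A \<le> card \<B>"
    unfolding covering_number_def by (intro cInf_lower) auto
  also have "\<dots> \<le> n" using card_image_le[OF \<U>(1)] \<U>(2) unfolding \<B>_def by (metis le_trans)
  finally show ?thesis .
qed

text \<open>
  To resolve the scale \<open>\<epsilon>\<close> one needs \<open>n \<approx> ln (d / \<epsilon>) / (- ln \<zeta>)\<close> steps, and then
  \<open>ln N \<le> n ln k\<close>; the initial diameter \<open>d\<close> and the rounding of \<open>n\<close> disappear in the limit.
\<close>

lemma fractal_dim_le_of_geometric_covers:
  fixes A :: "'a::metric_space set"
  assumes cover: "\<And>n. diam_cover (\<zeta> ^ n * d) (k ^ n) A"
    and \<zeta>: "0 < \<zeta>" "\<zeta> < 1" and d: "d > 0" and k: "k \<ge> 1"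
  shows "fractal_dim A \<le> ereal (ln (real k) / (- ln \<zeta>))"
proof -
  define q where "q = - ln \<zeta>"
  have q: "q > 0" using \<zeta> by (simp add: q_def)
  have lnk: "ln (real k) \<ge> 0" using k by simp
  let ?g = "\<lambda>\<epsilon>. (ln d / q - ln \<epsilon> / q + 1) * ln (real k) / (- ln \<epsilon>)"
  \<comment> \<open>the summand \<open>1\<close> in \<open>?g\<close> pays for rounding \<open>n\<close> up\<close>
  have le: "ln (real (covering_number \<epsilon> A)) / (- ln \<epsilon>) \<le> ?g \<epsilon>"
    if \<epsilon>: "0 < \<epsilon>" "\<epsilon> < min 1 d" for \<epsilon>
  proof -
    define n where "n = nat (\<lfloor>(ln d - ln \<epsilon>) / q\<rfloor> + 1)"
    have "ln \<epsilon> < ln d" using \<epsilon> by simp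
    then have pos: "0 \<le> (ln d - ln \<epsilon>) / q" using q by simp
    then have n: "(ln d - ln \<epsilon>) / q < real n" "real n \<le> (ln d - ln \<epsilon>) / q + 1"
      unfolding n_def by linarith+
    have "ln (\<zeta> ^ n * d) < ln \<epsilon>"
      using n(1) q \<zeta> d by (simp add: ln_mult ln_realpow q_def field_simps)
    then have "\<zeta> ^ n * d < \<epsilon>" using \<zeta> d \<epsilon> by simp
    then have "covering_number \<epsilon> A \<le> k ^ n"
      using covering_number_le_of_diam_cover[OF cover] \<zeta> d by simp
    then have "ln (real (covering_number \<epsilon> A)) \<le> real n * ln (real k)"
    proof (cases "covering_number \<epsilon> A = 0")
      case False
      have "real (covering_number \<epsilon> A) \<le> real k ^ n"
        using \<open>covering_number \<epsilon> A \<le> k ^ n\<close> by (metis of_nat_le_iff of_nat_power)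
      then have "ln (real (covering_number \<epsilon> A)) \<le> ln (real k ^ n)" using False k by (subst ln_le_cancel_iff) auto
      then show ?thesis using k by (simp add: ln_realpow)
    qed (use lnk in simp)
    also have "\<dots> \<le> ((ln d - ln \<epsilon>) / q + 1) * ln (real k)"
      using n(2) lnk by (rule mult_right_mono)
    finally show ?thesis
      using \<epsilon> by (intro divide_right_mono) (auto simp: diff_divide_distrib)
  qed
  have "fractal_dim A \<le> Limsup (at_right 0) (\<lambda>\<epsilon>. ereal (?g \<epsilon>))"
    unfolding fractal_dim_def
  proof (rule Limsup_mono)
    show "\<forall>\<^sub>F \<epsilon> in at_right 0. ereal (ln (real (covering_number \<epsilon> A)) / (- ln \<epsilon>)) \<le> ereal (?g \<epsilon>)"
      using eventually_at_right_less[of 0] eventually_at_rightI[of 0 "min 1 d" "\<lambda>\<epsilon>. \<epsilon> < min 1 d"] d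
      by (auto elim!: eventually_elim2 intro: le[simplified])
  qed
  also have "(?g \<longlongrightarrow> ln (real k) / q) (at_right 0)"
    using q by (real_asymp simp: field_simps)
  then have "Limsup (at_right 0) (\<lambda>\<epsilon>. ereal (?g \<epsilon>)) = ereal (ln (real k) / q)"
    by (intro lim_imp_Limsup tendsto_ereal) auto
  finally show ?thesis by (simp add: q_def)
qed

section \<open>Squeezing maps and the dimension of the attractor\<close>

text \<open>
  Pieces are chosen so that the projected images lie in a common ball of radius \<open>e * d / 2\<close>; two points
  of a piece then differ by at most \<open>e * d\<close> in the projection and by at most \<open>b * d\<close> in the complement.
\<close>

lemma diam_cover_squeezing_image:
  fixes f P :: "'a::real_normed_vector \<Rightarrow> 'a" and a b d e :: real
  assumes fin: "finite B" and ind: "independent B" and range: "\<And>x. P x \<in> span B"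
    and d: "d > 0" and a: "a \<ge> 0" and b: "b \<ge> 0" and e: "e > 0"
    and diam: "\<And>x y. x \<in> U \<Longrightarrow> y \<in> U \<Longrightarrow> dist x y \<le> d"
    and low: "\<And>x y. x \<in> U \<Longrightarrow> y \<in> U \<Longrightarrow> norm (P (f x) - P (f y)) \<le> a * norm (x - y)"
    and high: "\<And>x y. x \<in> U \<Longrightarrow> y \<in> U \<Longrightarrow>
      norm ((f x - P (f x)) - (f y - P (f y))) \<le> b * norm (x - y)"
  shows "diam_cover ((e + b) * d) (nat \<lfloor>(2 + 2 * a / e) ^ card B\<rfloor>) (f ` U)"
proof -
  have scale: "c * norm (x - y) \<le> c * d" if "x \<in> U" "y \<in> U" "c \<ge> 0" for x y c
    using diam[OF that(1,2)] that(3) by (simp add: dist_norm mult_left_mono)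
  have low': "dist u v \<le> a * d" if "u \<in> (\<lambda>x. P (f x)) ` U" "v \<in> (\<lambda>x. P (f x)) ` U" for u v
    using that by (auto simp: dist_norm intro!: order_trans[OF low scale[OF _ _ a]])
  obtain T where T: "finite T" "real (card T) \<le> (2 + 2 * (a * d) / (e * d)) ^ card B"
    "(\<lambda>x. P (f x)) ` U \<subseteq> (\<Union>w\<in>T. cball w (e * d / 2))"
    using isodiametric_cover[OF fin ind, of "(\<lambda>x. P (f x)) ` U" "e * d" "a * d"] range low' a d e
    by (auto simp: image_subset_iff)
  have "2 + 2 * (a * d) / (e * d) = 2 + 2 * a / e" using d by simp
  then have card: "card T \<le> nat \<lfloor>(2 + 2 * a / e) ^ card B\<rfloor>"
    using T(2) by (simp add: le_nat_floor)
  show ?thesis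
  proof (rule diam_cover_UN[OF T(1) card])
    show "f ` U = (\<Union>w\<in>T. {y \<in> f ` U. P y \<in> cball w (e * d / 2)})"
      using T(3) by fastforce
  next
    fix w u v
    assume "u \<in> {y \<in> f ` U. P y \<in> cball w (e * d / 2)}" "v \<in> {y \<in> f ` U. P y \<in> cball w (e * d / 2)}"
    then obtain x y where xy: "x \<in> U" "u = f x" "y \<in> U" "v = f y"
      and near: "dist w (P u) \<le> e * d / 2" "dist w (P v) \<le> e * d / 2" by auto
    have "dist (P u) (P v) \<le> e * d"
      using near dist_triangle3[of "P u" "P v" w] by linarith
    moreover have "norm ((u - P u) - (v - P v)) \<le> b * d"
      using high[OF xy(1,3)] scale[OF xy(1,3) b] unfolding xy(2,4) by linarith
    moreover have "u - v = (P u - P v) + ((u - P u) - (v - P v))" by simp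
    then have "norm (u - v) \<le> norm (P u - P v) + norm ((u - P u) - (v - P v))"
      by (metis norm_triangle_ineq)
    ultimately show "dist u v \<le> (e + b) * d" by (simp add: dist_norm distrib_right)
  qed
qed

lemma finite_rank_obtains_basis:
  assumes "finite_rank P"
  obtains B where "finite B" "independent B" "span B = range P" "card B = dim (range P)"
proof -
  obtain F where F: "finite F" "span F = range P" using assms by (auto simp: finite_rank_def)
  obtain B where B: "B \<subseteq> range P" "independent B" "range P \<subseteq> span B" "card B = dim (range P)"
    using basis_exists[of "range P"] by metis
  have "finite B" using independent_span_bound[OF F(1) B(2)] B(1) F(2) by simp
  moreover have "span B = range P"
    using B(1,3) F(2) by (metis span_mono span_span subset_antisym)
  ultimately show ?thesis using that B by blast
qed

theorem theorem2p2:
  fixes S :: "real \<Rightarrow> 'a::banach \<Rightarrow> 'a"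
    and A :: "'a set"
    and P :: "'a \<Rightarrow> 'a"
    and \<Lambda> :: nat
    and t0 M1 M2 M3 lam0 lam1 \<alpha> \<zeta> :: real
  assumes "semigroup_maps S"
    and "global_attractor S A"
    and "(SUP u\<in>A. ereal (norm u)) < \<infinity>"
    and "linear_projection P"
    and "finite_rank P"
    and "\<Lambda> = dim (range P)"
    and "\<Lambda> \<ge> 1"
    and "t0 > 0" and "M1 > 0" and "M2 > 0" and "M3 > 0"
    and "\<And>\<phi> \<psi>. \<phi> \<in> A \<Longrightarrow> \<psi> \<in> A \<Longrightarrow>
           norm (P (S t0 \<phi>) - P (S t0 \<psi>)) \<le> M1 * exp (lam0 * t0) * norm (\<phi> - \<psi>)"
    and "\<And>\<phi> \<psi>. \<phi> \<in> A \<Longrightarrow> \<psi> \<in> A \<Longrightarrow>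
           norm ((S t0 \<phi> - P (S t0 \<phi>)) - (S t0 \<psi> - P (S t0 \<psi>)))
             \<le> (M2 * exp (lam1 * t0) + M3 * exp (lam0 * t0)) * norm (\<phi> - \<psi>)"
    and "0 < \<alpha>" and "\<alpha> < M1"
    and "\<zeta> = \<alpha> * exp (lam0 * t0) + M2 * exp (lam1 * t0) + M3 * exp (lam0 * t0)"
    and "\<zeta> < 1"
  shows "fractal_dim A \<le>
           ereal ((ln (real \<Lambda>) + real \<Lambda> * ln (2 + 2 * M1 / \<alpha>)) / (- ln \<zeta>)) \<and>
         ereal ((ln (real \<Lambda>) + real \<Lambda> * ln (2 + 2 * M1 / \<alpha>)) / (- ln \<zeta>)) < \<infinity>"
proof -
  obtain B where B: "finite B" "independent B" "span B = range P" "card B = \<Lambda>"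
    using finite_rank_obtains_basis[OF assms(5)] assms(6) by metis
  define E where "E = exp (lam0 * t0)"
  define b where "b = M2 * exp (lam1 * t0) + M3 * E"
  define k where "k = nat \<lfloor>(2 + 2 * M1 / \<alpha>) ^ \<Lambda>\<rfloor>"
  have E: "E > 0" by (simp add: E_def)
  have b: "b > 0" using assms(10,11) E by (simp add: b_def add_pos_pos)
  have \<zeta>: "\<zeta> = \<alpha> * E + b" using assms(16) by (simp add: E_def b_def)
  have \<zeta>_pos: "\<zeta> > 0" using \<zeta> b E assms(14) by (simp add: add_pos_pos)
  have base: "1 \<le> 2 + 2 * M1 / \<alpha>" using assms(9,14) by (simp add: add_increasing2)
  have k: "1 \<le> k" "real k \<le> (2 + 2 * M1 / \<alpha>) ^ \<Lambda>"
    using one_le_power[OF base, of \<Lambda>] unfolding k_def by linarith+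
  have A: "bounded A" "S t0 ` A = A"
    using assms(2,8) by (auto simp: global_attractor_def invariant_set_def compact_imp_bounded)
  obtain d0 where d0: "\<And>x y. x \<in> A \<Longrightarrow> y \<in> A \<Longrightarrow> dist x y \<le> d0"
    using A(1) unfolding bounded_two_points by blast
  define d where "d = max d0 1"
  have d: "d > 0" "\<And>x y. x \<in> A \<Longrightarrow> y \<in> A \<Longrightarrow> dist x y \<le> d"
    using d0 by (auto simp: d_def intro: max.coboundedI1)
  have cover: "diam_cover (\<zeta> ^ n * d) (k ^ n) A" for n
  proof (induction n)
    case 0
    show ?case
      unfolding diam_cover_def using d by (intro exI[of _ "{A}"]) auto
  next
    case (Suc n)
    have "diam_cover (\<zeta> ^ Suc n * d) (k * k ^ n) (S t0 ` A)"
    proof (rule diam_cover_image[OF Suc])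
      fix U assume U: "U \<subseteq> A" "\<And>x y. x \<in> U \<Longrightarrow> y \<in> U \<Longrightarrow> dist x y \<le> \<zeta> ^ n * d"
      have "diam_cover ((\<alpha> * E + b) * (\<zeta> ^ n * d))
          (nat \<lfloor>(2 + 2 * (M1 * E) / (\<alpha> * E)) ^ card B\<rfloor>) (S t0 ` U)"
      proof (rule diam_cover_squeezing_image[where P = P, OF B(1,2)])
        show "P x \<in> span B" for x using B(3) by simp
        show "norm (P (S t0 x) - P (S t0 y)) \<le> M1 * E * norm (x - y)" if "x \<in> U" "y \<in> U" for x y
          using assms(12) that U(1) unfolding E_def by blast
        show "norm (S t0 x - P (S t0 x) - (S t0 y - P (S t0 y))) \<le> b * norm (x - y)"
          if "x \<in> U" "y \<in> U" for x y
          using assms(13) that U(1) unfolding E_def b_def by blast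
      qed (use d \<zeta>_pos E b assms(9,14) U(2) in auto)
      moreover have "(2 + 2 * (M1 * E) / (\<alpha> * E)) ^ card B = (2 + 2 * M1 / \<alpha>) ^ \<Lambda>"
        using E B(4) by simp
      ultimately show "diam_cover (\<zeta> ^ Suc n * d) k (S t0 ` U)"
        by (simp add: k_def \<zeta> mult.assoc)
    qed
    then show ?case using A(2) by simp
  qed
  have "ln (real k) \<le> ln ((2 + 2 * M1 / \<alpha>) ^ \<Lambda>)"
    using k base by (subst ln_le_cancel_iff) auto
  also have "\<dots> = real \<Lambda> * ln (2 + 2 * M1 / \<alpha>)"
    using base by (simp add: ln_realpow)
  also have "\<dots> \<le> ln (real \<Lambda>) + real \<Lambda> * ln (2 + 2 * M1 / \<alpha>)"
    using assms(7) by simp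
  finally have "ln (real k) / (- ln \<zeta>)
      \<le> (ln (real \<Lambda>) + real \<Lambda> * ln (2 + 2 * M1 / \<alpha>)) / (- ln \<zeta>)"
    using \<zeta>_pos assms(17) by (intro divide_right_mono) auto
  then show ?thesis
    using fractal_dim_le_of_geometric_covers[OF cover \<zeta>_pos assms(17) d(1) k(1)]
    by (simp add: order_trans[OF _ ereal_less_eq(3)[THEN iffD2]])
qed

end
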